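(* There exists a perfect difference set $\mathcal{A}\subset\mathbb{N}$ such that $$\limsup_{x\to\infty}\frac{A(x)}{\sqrt{x}}\ \ge\ \frac{1}{\sqrt{2}} .$$
   Context: $\mathbb{N}$ denotes the set of positive integers. For a set $\mathcal{A}$ of integers and an integer $u$, $d_{\mathcal{A}}(u)$ denotes the number of pairs $(a,a')\in\mathcal{A}\times\mathcal{A}$ with $u=a-a'$. The set $\mathcal{A}$ is a perfect difference set if $d_{\mathcal{A}}(u)=1$ for every integer $u\neq 0$. The counting function $A(x)$ counts the positive elements of $\mathcal{A}$ not exceeding $x$. *)

theory Defs
  imports Complex_Main "HOL-Library.Extended_Real" "HOL-Library.Liminf_Limsup"
begin

(* card is 0 on infinite sets; only the condition "= 1" is used below, which forces finiteness. *)
definition diff_rep :: "int set \<Rightarrow> int \<Rightarrow> nat" where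
  "diff_rep A u = card {(a, a') \<in> A \<times> A. u = a - a'}"

definition perfect_difference_set :: "int set \<Rightarrow> bool" where
  "perfect_difference_set A \<longleftrightarrow> (\<forall>u. u \<noteq> 0 \<longrightarrow> diff_rep A u = 1)"

definition counting :: "int set \<Rightarrow> real \<Rightarrow> nat" where
  "counting A x = card {a \<in> A. 0 < a \<and> real_of_int a \<le> x}"

end

theory Submission
  imports Defs "HOL-Number_Theory.Number_Theory" "HOL-Real_Asymp.Real_Asymp"
begin

text \<open>
  The set is the union of an increasing chain of finite Sidon sets of positive integers, that is,
  sets in which a nonzero difference determines the pair it comes from. The union is again a Sidon
  set, so every nonzero integer is a difference at most once.

  One step of the chain does two things. If the next positive integer \<open>u\<close> is not yet a
  difference, it appends \<open>x\<close> and \<open>x + u\<close> with \<open>x\<close> far beyond everything present; so in the limit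
  every nonzero integer is a difference exactly once. Then it appends a translate of a dense
  finite Sidon set \<open>R\<close>. For a prime \<open>p\<close>, Ruzsa's construction from a primitive root gives such
  an \<open>R\<close> with \<open>p - 1\<close> elements in an interval of length \<open>p (p - 1)\<close>. The set present before, say
  inside \<open>[1, D]\<close>, has only differences smaller than \<open>D\<close>, and since \<open>R\<close> is a Sidon set, at
  most \<open>D\<close> elements of \<open>R\<close> need to be dropped to avoid all of these. As soon as the translate
  starts beyond \<open>p (p - 1) + 2 D\<close>, no new coincidences arise
  (\<open>sidon_union_translate\<close>). So up to \<open>2 p (p - 1) + 2 D + 1\<close> there are at least \<open>p - 1 - D\<close> elements.
  As \<open>D\<close> is fixed while \<open>p\<close> may be taken arbitrarily large, the ratio \<open>A(x) / sqrt x\<close> comes as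
  close to \<open>1 / sqrt 2\<close> as desired: the factor \<open>sqrt 2\<close> is the price for shifting the dense block by
  its own length.
\<close>

section \<open>Sidon sets\<close>

definition sidon :: "int set \<Rightarrow> bool" where
  "sidon A \<longleftrightarrow> (\<forall>a\<in>A. \<forall>b\<in>A. \<forall>c\<in>A. \<forall>d\<in>A. a - b = c - d \<and> a \<noteq> b \<longrightarrow> a = c \<and> b = d)"

lemma sidonI:
  assumes "\<And>a b c d. a \<in> A \<Longrightarrow> b \<in> A \<Longrightarrow> c \<in> A \<Longrightarrow> d \<in> A \<Longrightarrow> a - b = c - d \<Longrightarrow> a \<noteq> b \<Longrightarrow> a = c"
  shows "sidon A"
  unfolding sidon_def using assms by (smt (verit, best))

lemma sidonD:
  assumes "sidon A" "a \<in> A" "b \<in> A" "c \<in> A" "d \<in> A" "a - b = c - d" "a \<noteq> b"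
  shows "a = c" "b = d"
  using assms unfolding sidon_def by blast+

lemma sidon_subset: "sidon B \<Longrightarrow> A \<subseteq> B \<Longrightarrow> sidon A"
  unfolding sidon_def by blast

lemma sidon_Union_chain:
  assumes "incseq A" "\<And>k. sidon (A k)"
  shows "sidon (\<Union>k. A k)"
proof (rule sidonI)
  fix a b c d
  assume "a \<in> (\<Union>k. A k)" "b \<in> (\<Union>k. A k)" "c \<in> (\<Union>k. A k)" "d \<in> (\<Union>k. A k)"
    and eq: "a - b = c - d" "a \<noteq> b"
  then obtain i j k l where ijkl: "a \<in> A i" "b \<in> A j" "c \<in> A k" "d \<in> A l" by blast
  define n where "n = Max {i, j, k, l}"
  have "A i \<subseteq> A n" "A j \<subseteq> A n" "A k \<subseteq> A n" "A l \<subseteq> A n"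
    unfolding n_def by (rule incseqD[OF assms(1)], simp)+
  with ijkl have "a \<in> A n" "b \<in> A n" "c \<in> A n" "d \<in> A n" by blast+
  then show "a = c" using sidonD(1)[OF assms(2)] eq by blast
qed

text \<open>An element of \<open>A\<close> plus one of \<open>S + m\<close> lies strictly between any sum of two elements of \<open>A\<close> and
  any sum of two elements of \<open>S + m\<close>. So in a coincidence of two sums of two elements both sides
  contain the same number of elements of \<open>A\<close>, and it reduces to a coincidence within \<open>A\<close>, within
  \<open>S\<close>, or between a difference of \<open>A\<close> and one of \<open>S\<close>.\<close>

lemma sidon_union_translate:
  fixes A S :: "int set"
  assumes A: "sidon A" "A \<subseteq> {1..D}" and S: "sidon S" "S \<subseteq> {0..N}"
    and disj: "\<And>a a' s s'. a \<in> A \<Longrightarrow> a' \<in> A \<Longrightarrow> s \<in> S \<Longrightarrow> s' \<in> S \<Longrightarrow> a - a' = s - s' \<Longrightarrow> s = s'"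
    and m: "m > N + 2 * D"
  shows "sidon (A \<union> (+) m ` S)"
proof (rule sidonI)
  let ?T = "(+) m ` S"
  have Ab: "1 \<le> a" "a \<le> D" if "a \<in> A" for a using A(2) that by auto
  have Tb: "m \<le> t" "t \<le> m + N" if "t \<in> ?T" for t using S(2) that by auto
  have T: "t = v \<and> u = w" if "t \<in> ?T" "u \<in> ?T" "v \<in> ?T" "w \<in> ?T" "t - u = v - w" "t \<noteq> u" for t u v w
    using that sidonD[OF S(1), of "t - m" "u - m" "v - m" "w - m"] by auto
  have AT: "t = u" if "a \<in> A" "b \<in> A" "t \<in> ?T" "u \<in> ?T" "a - b = t - u" for a b t u
    using that disj[of a b "t - m" "u - m"] by auto
  fix a b c d
  assume mem: "a \<in> A \<union> ?T" "b \<in> A \<union> ?T" "c \<in> A \<union> ?T" "d \<in> A \<union> ?T"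
    and eq: "a - b = c - d" and ne: "a \<noteq> b"
  show "a = c"
  proof (cases "a \<in> A"; cases "b \<in> A"; cases "c \<in> A"; cases "d \<in> A")
    assume "a \<in> A" "b \<in> A" "c \<in> A" "d \<in> A"
    then show ?thesis using sidonD(1)[OF A(1)] eq ne by blast
  next
    assume "a \<notin> A" "b \<notin> A" "c \<notin> A" "d \<notin> A"
    then show ?thesis using T[of a b c d] mem eq ne by blast
  next
    assume "a \<in> A" "b \<in> A" "c \<notin> A" "d \<notin> A"
    then show ?thesis using AT[of a b c d] mem eq ne by auto
  next
    assume "a \<notin> A" "b \<notin> A" "c \<in> A" "d \<in> A"
    then show ?thesis using AT[of c d a b] mem eq ne by auto
  next
    assume "a \<in> A" "b \<notin> A" "c \<in> A" "d \<notin> A"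
    then show ?thesis using AT[of a c b d] mem eq by auto
  next
    assume "a \<notin> A" "b \<in> A" "c \<notin> A" "d \<in> A"
    then show ?thesis using AT[of b d a c] mem eq by auto
  qed (use mem eq m Ab[of a] Ab[of b] Ab[of c] Ab[of d] Tb[of a] Tb[of b] Tb[of c] Tb[of d] in auto)
qed

text \<open>The discarded elements are the larger members of the pairs at distance less than \<open>D\<close>. In a
  Sidon set each positive integer below \<open>D\<close> is the distance of at most one pair.\<close>

lemma sidon_thin_out:
  assumes "sidon S" "finite S"
  obtains S' where "S' \<subseteq> S" "card S \<le> card S' + nat D"
    "\<And>s s'. s \<in> S' \<Longrightarrow> s' \<in> S' \<Longrightarrow> s \<noteq> s' \<Longrightarrow> \<bar>s - s'\<bar> \<ge> D"
proof -
  define E where "E = {s \<in> S. \<exists>s'\<in>S. 0 < s - s' \<and> s - s' < D}"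
  have "\<forall>s\<in>E. \<exists>s'. s' \<in> S \<and> 0 < s - s' \<and> s - s' < D" unfolding E_def by blast
  then obtain q where q: "\<And>s. s \<in> E \<Longrightarrow> q s \<in> S \<and> 0 < s - q s \<and> s - q s < D"
    by metis
  have ES: "E \<subseteq> S" unfolding E_def by blast
  have "inj_on (\<lambda>s. s - q s) E"
  proof (rule inj_onI)
    fix s t assume "s \<in> E" "t \<in> E" "s - q s = t - q t"
    then show "s = t" using sidonD(1)[OF assms(1), of s "q s" t "q t"] q[of s] q[of t] ES by auto
  qed
  moreover have "(\<lambda>s. s - q s) ` E \<subseteq> {1..D}" using q by fastforce
  ultimately have "card E \<le> card {1..D}" by (intro card_inj_on_le) auto
  then have cE: "card E \<le> nat D" by simp
  show ?thesis
  proof (rule that[of "S - E"])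
    show "card S \<le> card (S - E) + nat D"
      using cE card_Diff_subset[OF finite_subset[OF ES assms(2)] ES] by linarith
    fix s s' assume *: "s \<in> S - E" "s' \<in> S - E" "s \<noteq> s'"
    have "\<not> (0 < s - s' \<and> s - s' < D)" "\<not> (0 < s' - s \<and> s' - s < D)"
      using * unfolding E_def by blast+
    then show "\<bar>s - s'\<bar> \<ge> D" using *(3) by linarith
  qed blast
qed

section \<open>Dense finite Sidon sets\<close>

text \<open>Ruzsa's set: by the Chinese remainder theorem, let \<open>f i\<close> be congruent to \<open>i\<close> modulo \<open>p - 1\<close> and
  to \<open>g ^ i\<close> modulo \<open>p\<close>, where \<open>g\<close> is a primitive root. A sum \<open>f i + f l\<close> determines \<open>g ^ i + g ^ l\<close> and,
  through the exponent \<open>i + l\<close>, also the product \<open>g ^ i * g ^ l\<close> modulo \<open>p\<close>. These are the coefficients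
  of a quadratic polynomial over a field with the roots \<open>g ^ i\<close> and \<open>g ^ l\<close>, so they determine the
  unordered pair.\<close>

lemma ruzsa_sidon_set:
  fixes p :: nat
  assumes p: "prime p"
  obtains R where "sidon R" "R \<subseteq> {0..int (p * (p - 1))}" "card R = p - 1"
proof -
  have p2: "p \<ge> 2" using prime_ge_2_nat[OF p] .
  obtain g where g: "residue_primroot p g"
    using prime_primitive_root_exists[OF _ p] p2 by auto
  have cop: "coprime (p - 1) p"
    using p2 coprime_diff_one_left_nat[of p] by simp
  have ord: "ord p g = p - 1" and cg: "coprime p g"
    using g p by (auto simp: residue_primroot_def totient_prime)
  have "\<exists>x. x < (p - 1) * p \<and> [x = i] (mod (p - 1)) \<and> [x = g ^ i] (mod p)" for i
    using binary_chinese_remainder_unique_nat[OF cop, of i "g ^ i"] p2 by auto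
  then obtain f where f: "\<And>i. f i < (p - 1) * p" "\<And>i. [f i = i] (mod (p - 1))" "\<And>i. [f i = g ^ i] (mod p)"
    by metis
  have inj: "i = k" if "[i = k] (mod (p - 1))" "i < p - 1" "k < p - 1" for i k
    using cong_less_modulus_unique_nat[OF that] .
  have f_inj: "i = k" if "f i = f k" "i < p - 1" "k < p - 1" for i k
    using inj[of i k] that f(2)[of i] f(2)[of k] by (metis cong_sym cong_trans)
  have pow: "[g ^ i = g ^ k] (mod p) \<longleftrightarrow> [i = k] (mod (p - 1))" for i k
    using order_divides_expdiff[OF cg, of i k] ord by simp
  define R where "R = (\<lambda>i. int (f i)) ` {..<p - 1}"
  have "sidon R"
  proof (rule sidonI)
    fix a b c d assume "a \<in> R" "b \<in> R" "c \<in> R" "d \<in> R" and eq: "a - b = c - d" and ne: "a \<noteq> b"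
    then obtain i j k l where ijkl: "i < p - 1" "j < p - 1" "k < p - 1" "l < p - 1"
      "a = int (f i)" "b = int (f j)" "c = int (f k)" "d = int (f l)"
      unfolding R_def by auto
    have fsum: "f i + f l = f k + f j" using eq ijkl by linarith
    have "[i + l = k + j] (mod (p - 1))"
      using cong_add[OF f(2)[of i] f(2)[of l]] cong_add[OF f(2)[of k] f(2)[of j]] fsum
      by (metis cong_sym cong_trans)
    then have "[g ^ i * g ^ l = g ^ k * g ^ j] (mod p)"
      using pow[of "i + l" "k + j"] by (simp add: power_add)
    then have prod: "[int (g ^ i) * int (g ^ l) = int (g ^ k) * int (g ^ j)] (mod int p)"
      by (metis cong_int_iff of_nat_mult)
    have "[g ^ i + g ^ l = g ^ k + g ^ j] (mod p)"
      using cong_add[OF f(3)[of i] f(3)[of l]] cong_add[OF f(3)[of k] f(3)[of j]] fsum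
      by (metis cong_sym cong_trans)
    then have sum: "[int (g ^ i) + int (g ^ l) = int (g ^ k) + int (g ^ j)] (mod int p)"
      by (metis cong_int_iff of_nat_add)
    define x y z w where "x = int (g ^ i)" and "y = int (g ^ l)" and "z = int (g ^ k)" and "w = int (g ^ j)"
    have "int p dvd (x + y) - (z + w)" "int p dvd x * y - z * w"
      using prod sum unfolding x_def y_def z_def w_def by (simp_all add: cong_iff_dvd_diff)
    \<comment> \<open>The quadratic polynomial with roots \<open>z\<close> and \<open>w\<close> has the same coefficients as the one with roots
       \<open>x\<close> and \<open>y\<close>, so it vanishes at \<open>x\<close> modulo \<open>p\<close>.\<close>
    then have "int p dvd x * ((x + y) - (z + w)) - (x * y - z * w)"
      by (rule dvd_diff[OF dvd_mult])
    also have "x * ((x + y) - (z + w)) - (x * y - z * w) = (x - z) * (x - w)"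
      by (simp add: algebra_simps)
    finally have "int p dvd x - z \<or> int p dvd x - w"
      using p by (simp add: prime_dvd_mult_iff)
    then have "[g ^ i = g ^ k] (mod p) \<or> [g ^ i = g ^ j] (mod p)"
      unfolding x_def z_def w_def by (metis cong_iff_dvd_diff cong_int_iff)
    then have "i = k \<or> i = j" using pow inj ijkl by blast
    then show "a = c" using ne ijkl by auto
  qed
  moreover have "R \<subseteq> {0..int (p * (p - 1))}"
    unfolding R_def using f(1) by (auto simp: mult.commute less_imp_le simp del: of_nat_mult)
  moreover have "inj_on (\<lambda>i. int (f i)) {..<p - 1}"
    using f_inj by (auto intro!: inj_onI)
  then have "card R = p - 1" unfolding R_def by (simp add: card_image)
  ultimately show ?thesis using that by blast
qed

section \<open>Extending a finite Sidon set\<close>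

lemma finite_positive_bounded:
  fixes A :: "int set"
  assumes "finite A" "A \<subseteq> {0<..}"
  obtains D where "D \<ge> 0" "A \<subseteq> {1..D}"
proof (rule that[of "Max (insert 0 A)"])
  show "A \<subseteq> {1..Max (insert 0 A)}" using assms by (force simp: subset_iff)
qed (use assms in simp)

text \<open>The new pair \<open>m\<close>, \<open>m + u\<close> would produce a coincidence \<open>m + u - a = m - a'\<close> only if \<open>u\<close> were
  already the difference \<open>a - a'\<close>; this is why a pair is added only when \<open>u\<close> is still missing.\<close>

lemma sidon_extend_difference:
  fixes A :: "int set"
  assumes A: "finite A" "A \<subseteq> {0<..}" "sidon A" and u: "u > 0"
  obtains B where "finite B" "B \<subseteq> {0<..}" "sidon B" "A \<subseteq> B" "\<exists>a\<in>B. \<exists>b\<in>B. u = a - b"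
proof (cases "\<exists>a\<in>A. \<exists>b\<in>A. u = a - b")
  case True
  then show ?thesis using that[of A] A by blast
next
  case False
  obtain D where D: "D \<ge> 0" "A \<subseteq> {1..D}" using finite_positive_bounded[OF A(1,2)] .
  define m where "m = u + 2 * D + 1"
  let ?B = "A \<union> (+) m ` {0, u}"
  have disj: "s = s'" if "a \<in> A" "a' \<in> A" "s \<in> {0, u}" "s' \<in> {0, u}" "a - a' = s - s'" for a a' s s'
    using False that by (auto simp: algebra_simps)
  have "sidon {0, u}"
    unfolding sidon_def using u by auto
  then have "sidon ?B"
  proof (rule sidon_union_translate[OF A(3) D(2)])
    show "{0, u} \<subseteq> {0..u}" using u by simp
    show "m > u + 2 * D" by (simp add: m_def)
  qed (fact disj)
  moreover have "m > 0" using D u by (simp add: m_def)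
  ultimately show ?thesis
    using A u by (intro that[of ?B]) (auto intro!: bexI[of _ "m + u"] bexI[of _ m])
qed

lemma counting_mono:
  assumes "A \<subseteq> B"
  shows "counting A x \<le> counting B x"
  unfolding counting_def
proof (rule card_mono)
  have "{a \<in> B. 0 < a \<and> real_of_int a \<le> x} \<subseteq> {0..\<lfloor>x\<rfloor>}" by (auto simp: le_floor_iff)
  then show "finite {a \<in> B. 0 < a \<and> real_of_int a \<le> x}" by (rule finite_subset) simp
qed (use assms in auto)

text \<open>A single evaluation point \<open>x\<close> suffices for the limit superior, and the bound at \<open>x\<close> can only
  improve when the set is enlarged further. The point is \<open>x = m + N\<close>, the right end of the translated
  block, where \<open>N = p (p - 1)\<close>. All quantities are explicit in \<open>p\<close> and \<open>D\<close>, and \<open>D\<close> is fixed before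
  \<open>p\<close>, so the influence of the old set \<open>A\<close> disappears as \<open>p\<close> grows.\<close>

lemma sidon_extend_dense:
  fixes A :: "int set" and c X :: real
  assumes A: "finite A" "A \<subseteq> {0<..}" "sidon A" and c: "c < 1 / sqrt 2"
  obtains B x where "finite B" "B \<subseteq> {0<..}" "sidon B" "A \<subseteq> B" "x \<ge> X" "c \<le> counting B x / sqrt x"
proof -
  obtain D where D: "D \<ge> 0" "A \<subseteq> {1..D}" using finite_positive_bounded[OF A(1,2)] .
  define d where "d = real_of_int D"
  have "((\<lambda>p::nat. (real p - 1 - d) / sqrt (2 * (real p * (real p - 1)) + 2 * d + 1)) \<longlongrightarrow> inverse (2 powr (1 / 2))) at_top"
    by real_asymp
  then have "((\<lambda>p::nat. (real p - 1 - d) / sqrt (2 * (real p * (real p - 1)) + 2 * d + 1)) \<longlongrightarrow> 1 / sqrt 2) at_top"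
    by (simp add: powr_half_sqrt inverse_eq_divide)
  then have "eventually (\<lambda>p::nat. c < (real p - 1 - d) / sqrt (2 * (real p * (real p - 1)) + 2 * d + 1)) at_top"
    using c by (rule order_tendstoD(1))
  moreover have "eventually (\<lambda>p::nat. X \<le> 2 * (real p * (real p - 1)) + 2 * d + 1) at_top"
    by real_asymp
  ultimately have "eventually (\<lambda>p::nat. c < (real p - 1 - d) / sqrt (2 * (real p * (real p - 1)) + 2 * d + 1)
      \<and> X \<le> 2 * (real p * (real p - 1)) + 2 * d + 1) at_top"
    by eventually_elim simp
  then obtain p0 where p0: "\<And>p. p \<ge> p0 \<Longrightarrow> c < (real p - 1 - d) / sqrt (2 * (real p * (real p - 1)) + 2 * d + 1)
      \<and> X \<le> 2 * (real p * (real p - 1)) + 2 * d + 1"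
    unfolding eventually_at_top_linorder by blast
  obtain p where p: "prime p" "p > p0" using bigger_prime by blast
  define N where "N = int (p * (p - 1))"
  define m where "m = N + 2 * D + 1"
  obtain R where R: "sidon R" "R \<subseteq> {0..N}" "card R = p - 1"
    using ruzsa_sidon_set[OF p(1)] unfolding N_def .
  have finR: "finite R" using R(2) finite_subset by blast
  obtain S where S: "S \<subseteq> R" "card R \<le> card S + nat D"
      "\<And>s s'. s \<in> S \<Longrightarrow> s' \<in> S \<Longrightarrow> s \<noteq> s' \<Longrightarrow> \<bar>s - s'\<bar> \<ge> D"
    using sidon_thin_out[OF R(1) finR, of D] by blast
  have finS: "finite S" using S(1) finR finite_subset by blast
  let ?B = "A \<union> (+) m ` S"
  have disj: "s = s'" if "a \<in> A" "a' \<in> A" "s \<in> S" "s' \<in> S" "a - a' = s - s'" for a a' s s'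
  proof -
    have "a \<in> {1..D}" "a' \<in> {1..D}" using that(1,2) D(2) by blast+
    then have "\<bar>s - s'\<bar> < D" using that(5) by auto
    then show ?thesis using S(3)[OF that(3,4)] by fastforce
  qed
  have B_sidon: "sidon ?B"
  proof (rule sidon_union_translate[OF A(3) D(2) sidon_subset[OF R(1) S(1)]])
    show "S \<subseteq> {0..N}" using R(2) S(1) by blast
    show "m > N + 2 * D" by (simp add: m_def)
  qed (fact disj)
  have N: "N \<ge> 0" by (simp add: N_def)
  then have m0: "m > 0" using D(1) by (simp add: m_def)
  have B_pos: "?B \<subseteq> {0<..}" using A(2) S(1) R(2) m0 by (force simp: subset_iff)
  define x where "x = real_of_int (m + N)"
  have p1: "p \<ge> 1" using prime_ge_1_nat[OF p(1)] .
  have xeq: "x = 2 * (real p * (real p - 1)) + 2 * d + 1"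
    using p1 by (simp add: x_def m_def N_def d_def)
  have "card S = card ((+) m ` S)" by (simp add: card_image)
  also have "\<dots> = counting ((+) m ` S) x"
  proof -
    have "(+) m ` S = {a \<in> (+) m ` S. 0 < a \<and> real_of_int a \<le> x}"
      using m0 S(1) R(2) by (force simp: x_def subset_iff)
    then show ?thesis by (simp add: counting_def)
  qed
  also have "\<dots> \<le> counting ?B x" by (rule counting_mono) blast
  finally have "real p - 1 - d \<le> counting ?B x"
    using S(2) R(3) p1 D(1) by (simp add: d_def)
  then have "(real p - 1 - d) / sqrt x \<le> counting ?B x / sqrt x"
    using m0 N by (intro divide_right_mono) (auto simp: x_def)
  then have "c \<le> counting ?B x / sqrt x" "X \<le> x"
    using p0[of p] p(2) by (auto simp: xeq)
  then show ?thesis using A(1) finS B_sidon B_pos by (intro that[of ?B x]) auto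
qed

section \<open>The perfect difference set\<close>

lemma sidon_perfect_difference_set:
  assumes A: "sidon A" and ex: "\<And>u. u > 0 \<Longrightarrow> \<exists>a\<in>A. \<exists>b\<in>A. u = a - b"
  shows "perfect_difference_set A"
  unfolding perfect_difference_set_def
proof (intro allI impI)
  fix u :: int assume u: "u \<noteq> 0"
  have "\<exists>a\<in>A. \<exists>b\<in>A. u = a - b"
  proof (cases "u > 0")
    case False
    then obtain a b where "a \<in> A" "b \<in> A" "- u = a - b" using ex[of "- u"] u by auto
    then show ?thesis by (intro bexI[of _ b] bexI[of _ a]) auto
  qed (rule ex)
  then obtain a b where ab: "a \<in> A" "b \<in> A" "u = a - b" by blast
  have unique: "{(a, a') \<in> A \<times> A. u = a - a'} = {(a, b)}"
  proof (intro equalityI subsetI)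
    fix z assume "z \<in> {(a, a') \<in> A \<times> A. u = a - a'}"
    then obtain c d where z: "z = (c, d)" "c \<in> A" "d \<in> A" "u = c - d" by blast
    have "c - d = a - b" "c \<noteq> d" using z(4) ab(3) u by auto
    then show "z \<in> {(a, b)}" using sidonD[OF A z(2,3) ab(1,2)] z(1) by blast
  qed (use ab in blast)
  show "diff_rep A u = 1" unfolding diff_rep_def unique by simp
qed

lemma Limsup_at_top_ge:
  fixes f :: "real \<Rightarrow> real"
  assumes "\<And>c X. c < L \<Longrightarrow> \<exists>x\<ge>X. c \<le> f x"
  shows "Limsup at_top (\<lambda>x. ereal (f x)) \<ge> ereal L"
proof (rule ccontr)
  assume "\<not> ?thesis"
  then obtain c where c: "Limsup at_top (\<lambda>x. ereal (f x)) < ereal c" "ereal c < ereal L"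
    using ereal_dense2 by (meson not_le)
  from Limsup_lessD[OF c(1)] obtain X where "\<And>x. x \<ge> X \<Longrightarrow> f x < c"
    unfolding eventually_at_top_linorder by auto
  with assms[of c X] c(2) show False by force
qed

lemma eventually_one_over_Suc_less:
  fixes c L :: real
  assumes "c < L"
  shows "eventually (\<lambda>k. c < L - 1 / real (Suc k)) at_top"
proof -
  have "(\<lambda>k. L - 1 / real (Suc k)) \<longlonglongrightarrow> L" by real_asymp
  then show ?thesis using assms by (rule order_tendstoD(1))
qed

theorem theorem3:
  shows "\<exists>A :: int set. A \<subseteq> {n. 0 < n} \<and> perfect_difference_set A \<and>
    Limsup at_top (\<lambda>x::real. ereal (real (counting A x) / sqrt x)) \<ge> ereal (1 / sqrt 2)"
proof -
  \<comment> \<open>The evaluation points satisfy \<open>x \<ge> k\<close> so that they are unbounded along the chain.\<close>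
  define P :: "int set \<Rightarrow> bool" where "P A \<longleftrightarrow> finite A \<and> A \<subseteq> {0<..} \<and> sidon A" for A
  define Q :: "nat \<Rightarrow> int set \<Rightarrow> int set \<Rightarrow> bool" where
    "Q k A B \<longleftrightarrow> A \<subseteq> B \<and> (\<exists>a\<in>B. \<exists>b\<in>B. int (Suc k) = a - b) \<and>
       (\<exists>x\<ge>real k. 1 / sqrt 2 - 1 / real (Suc k) \<le> counting B x / sqrt x)" for k A B
  have "\<exists>A. \<forall>k. P (A k) \<and> Q k (A k) (A (Suc k))"
  proof (rule dependent_nat_choice)
    show "\<exists>A. P A" by (rule exI[of _ "{}"]) (simp add: P_def sidon_def)
  next
    fix A k assume "P A"
    then obtain B where B: "finite B" "B \<subseteq> {0<..}" "sidon B" "A \<subseteq> B" "\<exists>a\<in>B. \<exists>b\<in>B. int (Suc k) = a - b"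
      using sidon_extend_difference[of A "int (Suc k)"] by (auto simp: P_def)
    obtain C x where C: "finite C" "C \<subseteq> {0<..}" "sidon C" "B \<subseteq> C" "x \<ge> real k"
        "1 / sqrt 2 - 1 / real (Suc k) \<le> counting C x / sqrt x"
      using sidon_extend_dense[OF B(1-3), of "1 / sqrt 2 - 1 / real (Suc k)" "real k"] by auto
    have "\<exists>a\<in>C. \<exists>b\<in>C. int (Suc k) = a - b" using B(5) C(4) by blast
    moreover have "A \<subseteq> C" using B(4) C(4) by blast
    ultimately show "\<exists>C. P C \<and> Q k A C" using C unfolding P_def Q_def by blast
  qed
  then obtain A where A: "\<And>k. P (A k)" "\<And>k. Q k (A k) (A (Suc k))" by blast
  define U where "U = (\<Union>k. A k)"
  have "incseq A" using A(2) by (intro incseq_SucI) (auto simp: Q_def)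
  then have "sidon U" unfolding U_def using A(1) by (intro sidon_Union_chain) (auto simp: P_def)
  moreover have "\<exists>a\<in>U. \<exists>b\<in>U. u = a - b" if "u > 0" for u
  proof -
    have "int (Suc (nat (u - 1))) = u" using that by simp
    then show ?thesis using A(2)[of "nat (u - 1)"] unfolding Q_def U_def by auto
  qed
  ultimately have "perfect_difference_set U" by (rule sidon_perfect_difference_set)
  moreover have "U \<subseteq> {n. 0 < n}" using A(1) by (auto simp: U_def P_def)
  moreover have "Limsup at_top (\<lambda>x. ereal (counting U x / sqrt x)) \<ge> ereal (1 / sqrt 2)"
  proof (rule Limsup_at_top_ge)
    fix c X :: real assume "c < 1 / sqrt 2"
    then have "eventually (\<lambda>k. c < 1 / sqrt 2 - 1 / real (Suc k)) at_top"
      by (rule eventually_one_over_Suc_less)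
    moreover have "eventually (\<lambda>k. X \<le> real k) at_top" by real_asymp
    ultimately have "eventually (\<lambda>k. c < 1 / sqrt 2 - 1 / real (Suc k) \<and> max 0 X \<le> real k) at_top"
      by eventually_elim simp
    then obtain k where k: "c < 1 / sqrt 2 - 1 / real (Suc k)" "max 0 X \<le> real k"
      using eventually_happens'[OF sequentially_bot] by blast
    obtain x where x: "x \<ge> real k" "1 / sqrt 2 - 1 / real (Suc k) \<le> counting (A (Suc k)) x / sqrt x"
      using A(2)[of k] unfolding Q_def by blast
    have "counting (A (Suc k)) x / sqrt x \<le> counting U x / sqrt x"
      using x(1) k(2) by (intro divide_right_mono) (auto intro!: counting_mono simp: U_def)
    then show "\<exists>x\<ge>X. c \<le> counting U x / sqrt x"
      using k x by (intro exI[of _ x]) auto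
  qed
  ultimately show ?thesis by blast
qed

end
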